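(* Fix integers $n \geq d \geq 2$ and let $\sigma, B > 0$ and $\alpha \geq 1$. On the diagonal design $X_\alpha$, the following hold. (a) If $p \in (0,1]$ and $R > 0$, then there is a vector $\theta^\star \in \mathbb{R}^d$ such that $\|\theta^\star\|_p \leq R$ but $$\mathbf{E}_{y \sim \mathsf{N}(X_\alpha\theta^\star, \sigma^2 I_n)}\left[ \inf_{\lambda > 0} \left\| \hat\theta_\lambda(X_\alpha,y) - \theta^\star \right\|_2^2 \right] \geq \frac{9}{20000} \min\left\{ \frac{\sigma^2 B d}{n\alpha},\ R^2 \left( \frac{\sigma^2 B}{R^2 n}\alpha \right)^{1-p/2},\ R^2 \right\}.$$ (b) If $p = 0$ and $s \in \{1,\dots,d\}$, then there is a vector $\theta^\star \in \mathbb{R}^d$ which is $s$-sparse but $$\mathbf{E}_{y \sim \mathsf{N}(X_\alpha\theta^\star, \sigma^2 I_n)}\left[ \inf_{\lambda > 0} \left\| \hat\theta_\lambda(X_\alpha,y) - \theta^\star \right\|_2^2 \right] \geq \frac{9}{20000} \min\left\{ \frac{\sigma^2 B d}{n\alpha},\ \frac{\sigma^2 B s}{n}\alpha \right\}.$$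
   Context: For $\theta \in \mathbb{R}^d$ and $p \in (0,1]$, $\|\theta\|_p = \left(\sum_{i=1}^d |\theta_i|^p\right)^{1/p}$; a vector is $s$-sparse if it has at most $s$ nonzero coordinates. Let $k = \lfloor d/2 \rfloor$. The matrix $X_\alpha \in \mathbb{R}^{n\times d}$ has nonzero entries only on its main diagonal and satisfies $$\frac{1}{n} X_\alpha^T X_\alpha = \begin{pmatrix} \frac{\alpha}{B} I_k & 0 \\ 0 & \frac{1}{B} I_{d-k} \end{pmatrix}.$$ For $\lambda > 0$ the Lasso estimator is $$\hat\theta_\lambda(X,y) = \operatorname*{arg\,min}_{\vartheta \in \mathbb{R}^d} \left\{ \tfrac{1}{n} \|X\vartheta - y\|_2^2 + 2\lambda \|\vartheta\|_1 \right\}.$$ The infimum over $\lambda$ is inside the expectation. *)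

theory Defs
  imports "HOL-Probability.Probability" "Jordan_Normal_Form.Matrix"
begin

hide_const (open) Finite_Cartesian_Product.vec Finite_Cartesian_Product.mat
no_notation Finite_Cartesian_Product.vec_nth (infixl "$" 90)

definition lp_norm :: "real \<Rightarrow> real vec \<Rightarrow> real" where
  "lp_norm p v = (\<Sum>i<dim_vec v. \<bar>v $ i\<bar> powr p) powr (1 / p)"

definition sparse_vec :: "nat \<Rightarrow> real vec \<Rightarrow> bool" where
  "sparse_vec s v \<longleftrightarrow> card {i. i < dim_vec v \<and> v $ i \<noteq> 0} \<le> s"

text \<open>
  The design is only determined up to the signs of its diagonal entries, so it is
  captured by a predicate; results are to hold for every such matrix.
\<close>

definition diagonal_design :: "nat \<Rightarrow> nat \<Rightarrow> real \<Rightarrow> real \<Rightarrow> real mat \<Rightarrow> bool" where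
  "diagonal_design n d B \<alpha> X \<longleftrightarrow>
     X \<in> carrier_mat n d \<and> diagonal_mat X \<and>
     (let k = d div 2 in
      (1 / real n) \<cdot>\<^sub>m (transpose_mat X * X) =
        four_block_mat ((\<alpha> / B) \<cdot>\<^sub>m 1\<^sub>m k) (0\<^sub>m k (d - k))
                       (0\<^sub>m (d - k) k) ((1 / B) \<cdot>\<^sub>m 1\<^sub>m (d - k)))"

definition lasso_objective :: "real mat \<Rightarrow> real vec \<Rightarrow> real \<Rightarrow> real vec \<Rightarrow> real" where
  "lasso_objective X y lam \<theta> =
     (1 / real (dim_row X)) * (lp_norm 2 (X *\<^sub>v \<theta> - y))\<^sup>2 + 2 * lam * lp_norm 1 \<theta>"

text \<open>
  The constant \<open>arg_min\<close> selects some minimiser. For the designs above (with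
  \<open>n \<ge> d\<close>, \<open>B > 0\<close> and \<open>\<alpha> > 0\<close>) the objective is strictly convex
  and coercive, so the minimiser exists and is unique.
\<close>

definition lasso :: "real mat \<Rightarrow> real vec \<Rightarrow> real \<Rightarrow> real vec" where
  "lasso X y lam = arg_min (lasso_objective X y lam) (\<lambda>\<theta>. \<theta> \<in> carrier_vec (dim_col X))"

text \<open>
  The law \<open>N(\<mu>, \<sigma>\<^sup>2 I)\<close>, as a measure on functions on the index set
  \<open>{..<dim_vec \<mu>}\<close>; note that \<open>normal_density\<close> takes the standard deviation.
\<close>

definition isotropic_gaussian :: "real vec \<Rightarrow> real \<Rightarrow> (nat \<Rightarrow> real) measure" where
  "isotropic_gaussian \<mu> \<sigma> =
     PiM {..<dim_vec \<mu>} (\<lambda>i. density lborel (normal_density (\<mu> $ i) \<sigma>))"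

text \<open>
  The Bochner integral is \<open>0\<close> for a non-integrable function, so a positive lower bound on
  this expectation entails integrability. The infimum is of a nonempty set of
  nonnegative reals.
\<close>

definition oracle_lasso_risk :: "real mat \<Rightarrow> real \<Rightarrow> real vec \<Rightarrow> real" where
  "oracle_lasso_risk X \<sigma> \<theta> =
     (\<integral>\<omega>. (INF lam\<in>{0<..}. (lp_norm 2 (lasso X (vec (dim_row X) \<omega>) lam - \<theta>))\<^sup>2)
        \<partial>isotropic_gaussian (X *\<^sub>v \<theta>) \<sigma>)"

end

theory Submission
  imports Defs
begin

text \<open>
  On a diagonal design the Lasso decouples into scalar problems. With curvatures
  \<open>a i\<close> (the squared diagonal entries divided by \<open>n\<close>) and correlations
  \<open>b i = X $$ (i, i) * y $ i / n\<close>, its \<open>i\<close>-th coordinate is \<open>b i\<close> soft-thresholded at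
  \<open>lam\<close> and divided by \<open>a i\<close> (\<open>lasso_diagonal\<close>). So every coordinate shares the threshold
  \<open>lam\<close> before the division, although the noise in \<open>b i\<close> has standard deviation proportional
  to \<open>sqrt (a i)\<close>. A single \<open>lam\<close> cannot serve two different curvatures, and the
  lower bound exploits this: put no signal on the \<open>k = d div 2\<close> coordinates of curvature
  \<open>\<alpha> / B\<close>, and a signal \<open>M\<close> on \<open>m\<close> of the coordinates of curvature \<open>1 / B\<close>.
  Let \<open>l = \<sigma> / 4 * sqrt (\<alpha> / (n * B))\<close>, a quarter of the noise level of the first kind.

  If \<open>lam \<le> l\<close>, every signal-free coordinate whose noise is at least half a standard
  deviation survives the threshold and costs at least \<open>\<sigma>\<^sup>2 * B / (16 * n * \<alpha>)\<close>. If
  \<open>l \<le> lam\<close>, every signal coordinate whose noise does not point away from zero is biased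
  towards zero by at least \<open>min M (B * l)\<close>, where \<open>B * l = sqrt (\<sigma>\<^sup>2 * B * \<alpha> / n) / 4\<close>. The
  two kinds of bad coordinates do not depend on \<open>lam\<close>, so the infimum over \<open>lam\<close> is at least
  the minimum of the two costs. Let \<open>e \<le> k\<close> and \<open>f \<le> m\<close> be the numbers of bad coordinates.
  As \<open>e / k\<close> and \<open>f / m\<close> lie in the unit interval, that minimum is at least
  \<open>(e / k) * (f / m)\<close> times its value for \<open>e = k\<close>, \<open>f = m\<close>
  (\<open>min_ge_product_of_averages\<close>). The product expands into pairs of independent
  events of probability at least \<open>3 / 5\<close> and \<open>1 / 2\<close>, and the expected infimum is therefore at
  least \<open>3 / 10\<close> of the minimum of the two full costs (\<open>oracle_lasso_risk_block_signal\<close>).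

  The Bochner integral bounds nothing unless the infimum is integrable. It is
  measurable because the loss is continuous in \<open>lam\<close>, so that rational \<open>lam\<close> suffice, and it is
  bounded because a large \<open>lam\<close> yields the zero estimator
  (\<open>integrable_INF_threshold_loss\<close>).

  Both parts of the theorem are choices of \<open>m\<close> and \<open>M\<close>. Write
  \<open>Q = \<sigma>\<^sup>2 * B * \<alpha> / n\<close>. In the sparse case, \<open>M = sqrt Q\<close> and \<open>m\<close> is \<open>s\<close> capped at the number of
  available coordinates. In the \<open>lp\<close> case, a budget \<open>R \<le> sqrt Q\<close> is spent on one coordinate;
  a larger one pays for about \<open>(R / sqrt Q) powr p\<close> coordinates of size \<open>sqrt Q\<close>.
\<close>

section \<open>The Lasso on a diagonal design\<close>

text \<open>
  Soft thresholding is written as what remains of \<open>b\<close> after clipping it to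
  \<open>[- lam, lam]\<close>: the clipped part is the subgradient of the penalty at the minimiser, and
  continuity in both arguments is evident.
\<close>

definition soft_threshold :: "real \<Rightarrow> real \<Rightarrow> real" where
  "soft_threshold b lam = b - max (- lam) (min lam b)"

text \<open>
  The clipped part \<open>c\<close> of \<open>b\<close> is a subgradient of \<open>\<lambda>t. lam * \<bar>t\<bar>\<close> at \<open>s\<close>, that is
  \<open>c * t \<le> lam * \<bar>t\<bar>\<close> with equality at \<open>s\<close>. The quadratic part contributes the remainder
  \<open>a * (t - s)\<^sup>2\<close>, which gives uniqueness of the minimiser along with optimality.
\<close>

lemma soft_threshold_minimises:
  fixes a b lam t :: real
  assumes "a > 0" and "lam \<ge> 0"
  defines "s \<equiv> soft_threshold b lam / a"
  shows "a * s\<^sup>2 - 2 * b * s + 2 * lam * \<bar>s\<bar> + a * (t - s)\<^sup>2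
           \<le> a * t\<^sup>2 - 2 * b * t + 2 * lam * \<bar>t\<bar>"
proof -
  define c where "c = max (- lam) (min lam b)"
  have as: "a * s = b - c"
    using assms(1) by (simp add: s_def soft_threshold_def c_def)
  have "\<bar>c\<bar> \<le> lam"
    using assms(2) by (auto simp: c_def)
  then have "c * t \<le> lam * \<bar>t\<bar>"
    using abs_ge_self[of "c * t"] mult_right_mono[of "\<bar>c\<bar>" lam "\<bar>t\<bar>"] by (simp add: abs_mult)
  moreover have "c * (b - c) = lam * \<bar>b - c\<bar>"
    using assms(2) by (auto simp: c_def max_def min_def abs_if algebra_simps)
  then have "c * (a * s) = lam * (a * \<bar>s\<bar>)"
    using assms(1) by (simp add: as[symmetric] abs_mult)
  then have "c * s = lam * \<bar>s\<bar>"
    using assms(1) by simp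
  moreover have "b = a * s + c"
    using as by simp
  then have "a * t\<^sup>2 - 2 * b * t - (a * s\<^sup>2 - 2 * b * s) - a * (t - s)\<^sup>2 = 2 * (c * s) - 2 * (c * t)"
    by (simp add: power2_eq_square algebra_simps)
  ultimately show ?thesis
    by linarith
qed

lemma lp_norm_2_squared: "(lp_norm 2 v)\<^sup>2 = (\<Sum>i<dim_vec v. (v $ i)\<^sup>2)"
proof -
  have "(\<Sum>i<dim_vec v. \<bar>v $ i\<bar> powr 2) = (\<Sum>i<dim_vec v. (v $ i)\<^sup>2)"
    by simp
  then show ?thesis
    unfolding lp_norm_def by (simp add: powr_half_sqrt sum_nonneg)
qed

lemma lp_norm_1: "lp_norm 1 v = (\<Sum>i<dim_vec v. \<bar>v $ i\<bar>)"
  by (simp add: lp_norm_def sum_nonneg)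

lemma diagonal_mult_mat_vec:
  assumes "X \<in> carrier_mat n d" "diagonal_mat X" "v \<in> carrier_vec d" "i < n"
  shows "(X *\<^sub>v v) $ i = (if i < d then X $$ (i, i) * v $ i else 0)"
proof -
  have "(X *\<^sub>v v) $ i = (\<Sum>j<d. X $$ (i, j) * v $ j)"
    using assms by (auto simp: scalar_prod_def atLeast0LessThan intro!: sum.cong)
  also have "\<dots> = (\<Sum>j<d. if j = i then X $$ (i, i) * v $ i else 0)"
    using assms by (intro sum.cong) (auto simp: diagonal_mat_def)
  finally show ?thesis
    by simp
qed

text \<open>
  The objective is a sum of the scalar objectives of \<open>soft_threshold_minimises\<close> and a constant
  \<open>C\<close>. The strong-convexity remainders make the minimiser unique, so the choice made by
  \<open>arg_min\<close> is forced.
\<close>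

lemma lasso_diagonal:
  fixes X :: "real mat" and lam :: real
  assumes X: "X \<in> carrier_mat n d" "diagonal_mat X" and dn: "d \<le> n"
    and y: "y \<in> carrier_vec n" and lam: "lam \<ge> 0"
    and a: "\<And>i. i < d \<Longrightarrow> (X $$ (i, i))\<^sup>2 / real n = a i" "\<And>i. i < d \<Longrightarrow> a i > 0"
  shows "lasso X y lam =
    vec d (\<lambda>i. soft_threshold (X $$ (i, i) * y $ i / real n) lam / a i)"
proof -
  define b where "b i = X $$ (i, i) * y $ i / real n" for i
  define s where "s = vec d (\<lambda>i. soft_threshold (b i) lam / a i)"
  define C where "C = (\<Sum>i<n. (y $ i)\<^sup>2) / real n"
  have obj: "lasso_objective X y lam v =
      (\<Sum>i<d. a i * (v $ i)\<^sup>2 - 2 * b i * v $ i + 2 * lam * \<bar>v $ i\<bar>) + C"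
    if v: "v \<in> carrier_vec d" for v
  proof -
    have "(lp_norm 2 (X *\<^sub>v v - y))\<^sup>2 = (\<Sum>i<n. ((X *\<^sub>v v) $ i - y $ i)\<^sup>2)"
      using X y v by (simp add: lp_norm_2_squared)
    also have "\<dots> = (\<Sum>i<n. (if i \<in> {..<d}
        then (X $$ (i, i))\<^sup>2 * (v $ i)\<^sup>2 - 2 * (X $$ (i, i) * y $ i) * v $ i else 0) + (y $ i)\<^sup>2)"
      using diagonal_mult_mat_vec[OF X v]
      by (intro sum.cong) (auto simp: power2_eq_square algebra_simps)
    also have "\<dots> = (\<Sum>i<d. (X $$ (i, i))\<^sup>2 * (v $ i)\<^sup>2 - 2 * (X $$ (i, i) * y $ i) * v $ i)
        + (\<Sum>i<n. (y $ i)\<^sup>2)"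
      using dn by (simp only: sum.distrib, subst sum.inter_restrict[symmetric])
        (auto intro!: sum.cong)
    finally have "(1 / real n) * (lp_norm 2 (X *\<^sub>v v - y))\<^sup>2 =
        (\<Sum>i<d. (X $$ (i, i))\<^sup>2 / real n * (v $ i)\<^sup>2 - 2 * b i * v $ i) + C"
      by (simp add: C_def b_def add_divide_distrib sum_divide_distrib diff_divide_distrib)
    also have "(\<Sum>i<d. (X $$ (i, i))\<^sup>2 / real n * (v $ i)\<^sup>2 - 2 * b i * v $ i)
        = (\<Sum>i<d. a i * (v $ i)\<^sup>2 - 2 * b i * v $ i)"
      using a(1) by (intro sum.cong) auto
    finally show ?thesis
      using X v by (simp add: lasso_objective_def lp_norm_1 sum.distrib sum_distrib_left)
  qed
  have s: "s \<in> carrier_vec d"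
    by (simp add: s_def)
  have key: "lasso_objective X y lam s + (\<Sum>i<d. a i * (v $ i - s $ i)\<^sup>2)
      \<le> lasso_objective X y lam v" if v: "v \<in> carrier_vec d" for v
  proof -
    have "(\<Sum>i<d. a i * (s $ i)\<^sup>2 - 2 * b i * s $ i + 2 * lam * \<bar>s $ i\<bar> + a i * (v $ i - s $ i)\<^sup>2)
      \<le> (\<Sum>i<d. a i * (v $ i)\<^sup>2 - 2 * b i * v $ i + 2 * lam * \<bar>v $ i\<bar>)"
    proof (rule sum_mono)
      fix i assume "i \<in> {..<d}"
      then show "a i * (s $ i)\<^sup>2 - 2 * b i * s $ i + 2 * lam * \<bar>s $ i\<bar> + a i * (v $ i - s $ i)\<^sup>2
          \<le> a i * (v $ i)\<^sup>2 - 2 * b i * v $ i + 2 * lam * \<bar>v $ i\<bar>"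
        using soft_threshold_minimises[OF a(2) lam, of i "b i" "v $ i"] by (simp add: s_def)
    qed
    then show ?thesis
      by (simp add: obj[OF v] obj[OF s] sum.distrib)
  qed
  have "arg_min (lasso_objective X y lam) (\<lambda>v. v \<in> carrier_vec d) = s"
  proof (rule arg_minI)
    show "s \<in> carrier_vec d" by (rule s)
    show "\<not> lasso_objective X y lam v < lasso_objective X y lam s" if "v \<in> carrier_vec d" for v
    proof -
      have "(\<Sum>i<d. a i * (v $ i - s $ i)\<^sup>2) \<ge> 0"
        using a(2) by (intro sum_nonneg) (simp add: less_imp_le)
      then show ?thesis
        using key[OF that] by linarith
    qed
  next
    fix v assume v: "v \<in> carrier_vec d"
      and min: "\<forall>w. w \<in> carrier_vec d \<longrightarrow> \<not> lasso_objective X y lam w < lasso_objective X y lam v"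
    have "(\<Sum>i<d. a i * (v $ i - s $ i)\<^sup>2) \<le> 0"
      using key[OF v] min s by fastforce
    moreover have nn: "a i * (v $ i - s $ i)\<^sup>2 \<ge> 0" if "i < d" for i
      using a(2)[OF that] by simp
    ultimately have "(\<Sum>i<d. a i * (v $ i - s $ i)\<^sup>2) = 0"
      by (intro antisym sum_nonneg) auto
    then have "\<forall>i\<in>{..<d}. a i * (v $ i - s $ i)\<^sup>2 = 0"
      using nn by (subst (asm) sum_nonneg_eq_0_iff) auto
    then have "v $ i = s $ i" if "i < d" for i
      using a(2)[OF that] that by (metis lessThan_iff less_irrefl mult_eq_0_iff right_minus_eq zero_eq_power2)
    then show "v = s"
      using v s by auto
  qed
  then show ?thesis
    using X by (simp add: lasso_def s_def b_def)
qed

lemma diagonal_design_entries: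
  assumes "diagonal_design n d B \<alpha> X" and dn: "d \<le> n" and i: "i < d"
  shows "(X $$ (i, i))\<^sup>2 / real n = (if i < d div 2 then \<alpha> / B else 1 / B)"
proof -
  have X: "X \<in> carrier_mat n d" "diagonal_mat X"
    using assms(1) by (auto simp: diagonal_design_def)
  have "(transpose_mat X * X) $$ (i, i) = (\<Sum>r<n. X $$ (r, i) * X $$ (r, i))"
    using X i by (simp add: scalar_prod_def atLeast0LessThan)
  also have "\<dots> = (\<Sum>r<n. if r = i then (X $$ (i, i))\<^sup>2 else 0)"
    using X i by (intro sum.cong) (auto simp: diagonal_mat_def power2_eq_square)
  also have "\<dots> = (X $$ (i, i))\<^sup>2"
    using i dn by simp
  finally have "(X $$ (i, i))\<^sup>2 / real n = ((1 / real n) \<cdot>\<^sub>m (transpose_mat X * X)) $$ (i, i)"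
    using X i by simp
  also have "\<dots> = four_block_mat ((\<alpha> / B) \<cdot>\<^sub>m 1\<^sub>m (d div 2)) (0\<^sub>m (d div 2) (d - d div 2))
      (0\<^sub>m (d - d div 2) (d div 2)) ((1 / B) \<cdot>\<^sub>m 1\<^sub>m (d - d div 2)) $$ (i, i)"
    using assms(1) by (simp add: diagonal_design_def Let_def)
  also have "\<dots> = (if i < d div 2 then \<alpha> / B else 1 / B)"
    using i by (subst index_mat_four_block) auto
  finally show ?thesis .
qed

section \<open>Two events for a normal variable\<close>

text \<open>
  The density never exceeds \<open>2 / (5 * \<sigma>)\<close>, so the complementary interval, of length
  \<open>\<sigma>\<close>, has mass at most \<open>2 / 5\<close>.
\<close>

lemma normal_anticoncentration:
  fixes \<mu> \<sigma> :: real
  assumes "\<sigma> > 0"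
  shows "measure (density lborel (normal_density \<mu> \<sigma>)) {w. \<sigma> / 2 \<le> \<bar>w - \<mu>\<bar>} \<ge> 3 / 5"
proof -
  let ?N = "density lborel (normal_density \<mu> \<sigma>)"
  interpret N: prob_space ?N
    by (rule prob_space_normal_density[OF assms])
  let ?A = "{\<mu> - \<sigma> / 2<..<\<mu> + \<sigma> / 2}"
  have dens: "normal_density \<mu> \<sigma> x \<le> 2 / 5 / \<sigma>" for x
  proof -
    have "(5 / 2)\<^sup>2 \<le> 2 * pi"
      using pi_approx(1) by (simp add: power2_eq_square)
    then have "(5 / 2)\<^sup>2 * \<sigma>\<^sup>2 \<le> 2 * pi * \<sigma>\<^sup>2"
      by (rule mult_right_mono) simp
    then have "5 / 2 * \<sigma> \<le> sqrt (2 * pi * \<sigma>\<^sup>2)"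
      using assms by (intro real_le_rsqrt) (simp only: power_mult_distrib)
    then have "1 / sqrt (2 * pi * \<sigma>\<^sup>2) \<le> 1 / (5 / 2 * \<sigma>)"
      using assms by (intro divide_left_mono) auto
    moreover have "exp (- ((x - \<mu>)\<^sup>2) / (2 * \<sigma>\<^sup>2)) \<le> 1"
      by simp
    ultimately have "1 / sqrt (2 * pi * \<sigma>\<^sup>2) * exp (- ((x - \<mu>)\<^sup>2) / (2 * \<sigma>\<^sup>2)) \<le> 1 / (5 / 2 * \<sigma>) * 1"
      using assms by (intro mult_mono) auto
    then show ?thesis
      by (simp add: normal_density_def)
  qed
  have "emeasure ?N ?A = (\<integral>\<^sup>+x. ennreal (normal_density \<mu> \<sigma> x) * indicator ?A x \<partial>lborel)"
    by (subst emeasure_density) auto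
  also have "\<dots> \<le> (\<integral>\<^sup>+x. ennreal (2 / 5 / \<sigma>) * indicator ?A x \<partial>lborel)"
    using dens by (intro nn_integral_mono mult_right_mono ennreal_leI) auto
  also have "\<dots> = ennreal (2 / 5 / \<sigma>) * ennreal \<sigma>"
    using assms by (subst nn_integral_cmult_indicator) auto
  also have "\<dots> = ennreal (2 / 5)"
    using assms by (subst ennreal_mult[symmetric]) auto
  finally have "measure ?N ?A \<le> 2 / 5"
    by (simp add: N.emeasure_eq_measure)
  moreover have "measure ?N (space ?N - ?A) = 1 - measure ?N ?A"
    by (rule N.prob_compl) simp
  moreover have "space ?N - ?A = {w. \<sigma> / 2 \<le> \<bar>w - \<mu>\<bar>}"
    by (auto simp: abs_if field_simps)
  ultimately show ?thesis
    by simp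
qed

text \<open>
  Reflection at the mean exchanges the event with \<open>c * (w - \<mu>) \<ge> 0\<close>, and the two cover the
  line. The factor \<open>c\<close> stands for a diagonal entry of the design, whose sign is arbitrary.
\<close>

lemma normal_half_line:
  fixes \<mu> \<sigma> c :: real
  assumes "\<sigma> > 0"
  shows "measure (density lborel (normal_density \<mu> \<sigma>)) {w. c * (w - \<mu>) \<le> 0} \<ge> 1 / 2"
proof -
  let ?N = "density lborel (normal_density \<mu> \<sigma>)"
  interpret N: prob_space ?N
    by (rule prob_space_normal_density[OF assms])
  let ?A = "{w. c * (w - \<mu>) \<le> 0}" and ?A' = "{w. c * (w - \<mu>) \<ge> 0}"
  have [measurable]: "?A \<in> sets borel" "?A' \<in> sets borel"
    by measurable
  have "emeasure ?N ?A = (\<integral>\<^sup>+x. ennreal (normal_density \<mu> \<sigma> x) * indicator ?A x \<partial>lborel)"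
    by (subst emeasure_density) auto
  also have "\<dots> = (\<integral>\<^sup>+x. ennreal (normal_density \<mu> \<sigma> (2 * \<mu> + (-1) * x))
      * indicator ?A (2 * \<mu> + (-1) * x) \<partial>lborel)"
    by (subst nn_integral_real_affine[where c = "-1" and t = "2 * \<mu>"]) auto
  also have "\<dots> = (\<integral>\<^sup>+x. ennreal (normal_density \<mu> \<sigma> x) * indicator ?A' x \<partial>lborel)"
    by (intro nn_integral_cong)
      (auto simp: normal_density_def indicator_def power2_commute algebra_simps)
  also have "\<dots> = emeasure ?N ?A'"
    by (subst emeasure_density) auto
  finally have "measure ?N ?A = measure ?N ?A'"
    by (simp add: N.emeasure_eq_measure)
  moreover have "1 = measure ?N (?A \<union> ?A')"
  proof -
    have "?A \<union> ?A' = space ?N" by auto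
    then show ?thesis using N.prob_space by simp
  qed
  moreover have "measure ?N (?A \<union> ?A') \<le> measure ?N ?A + measure ?N ?A'"
    by (rule measure_Un_le) auto
  ultimately show ?thesis
    by linarith
qed

section \<open>Integrability of the oracle loss\<close>

lemma soft_threshold_eq_0: "\<bar>b\<bar> \<le> lam \<Longrightarrow> soft_threshold b lam = 0"
  by (auto simp: soft_threshold_def)

lemma continuous_on_soft_threshold: "continuous_on A (soft_threshold b)"
  unfolding soft_threshold_def by (intro continuous_intros)

lemma borel_measurable_soft_threshold [measurable]:
  "(\<lambda>b. soft_threshold b lam) \<in> borel_measurable borel"
  unfolding soft_threshold_def by measurable

text \<open>
  By continuity, a value below \<open>c\<close> at some \<open>lam\<close> persists at a nearby rational, so the
  uncountable infimum is a countable one.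
\<close>

lemma borel_measurable_INF_continuous:
  fixes f :: "real \<Rightarrow> 'a \<Rightarrow> real"
  assumes meas: "\<And>lam. lam > 0 \<Longrightarrow> f lam \<in> borel_measurable M"
    and cont: "\<And>x. continuous_on {0<..} (\<lambda>lam. f lam x)"
    and nonneg: "\<And>lam x. lam > 0 \<Longrightarrow> 0 \<le> f lam x"
  shows "(\<lambda>x. INF lam\<in>{0<..}. f lam x) \<in> borel_measurable M"
proof -
  have bdd: "bdd_below ((\<lambda>lam. f lam x) ` {0<..})" for x
    using nonneg by (intro bdd_belowI[where m = 0]) auto
  have "(INF lam\<in>{0<..}. f lam x) = (INF lam\<in>{0<..} \<inter> \<rat>. f lam x)" for x
  proof (rule antisym)
    have "(1 :: real) \<in> {0<..} \<inter> \<rat>"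
      by simp
    then show "(INF lam\<in>{0<..}. f lam x) \<le> (INF lam\<in>{0<..} \<inter> \<rat>. f lam x)"
      by (intro cINF_superset_mono[OF _ bdd]) (blast, auto)
    show "(INF lam\<in>{0<..} \<inter> \<rat>. f lam x) \<le> (INF lam\<in>{0<..}. f lam x)"
    proof (rule cINF_greatest)
      fix lam :: real assume "lam \<in> {0<..}"
      show "(INF lam\<in>{0<..} \<inter> \<rat>. f lam x) \<le> f lam x"
      proof (rule dense_ge)
        fix c assume "f lam x < c"
        have "open ((\<lambda>lam. f lam x) -` {..<c} \<inter> {0<..})"
          using cont[of x] by (simp add: continuous_on_open_vimage)
        moreover have "lam \<in> (\<lambda>lam. f lam x) -` {..<c} \<inter> {0<..}"
          using \<open>f lam x < c\<close> \<open>lam \<in> {0<..}\<close> by simp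
        ultimately obtain e where e: "e > 0"
          "\<And>l. dist l lam < e \<Longrightarrow> l \<in> (\<lambda>lam. f lam x) -` {..<c} \<inter> {0<..}"
          unfolding open_dist by blast
        obtain q where q: "q \<in> \<rat>" "lam < q" "q < lam + e"
          using Rats_dense_in_real[of lam "lam + e"] e(1) by auto
        then have "q \<in> (\<lambda>lam. f lam x) -` {..<c} \<inter> {0<..}"
          by (intro e(2)) (simp add: dist_real_def)
        moreover have "(INF lam\<in>{0<..} \<inter> \<rat>. f lam x) \<le> f q x" if "q > 0"
          using q(1) that by (intro cINF_lower bdd_below_mono[OF bdd]) auto
        ultimately show "(INF lam\<in>{0<..} \<inter> \<rat>. f lam x) \<le> c"
          by force
      qed
    qed simp
  qed
  moreover have "(\<lambda>x. INF lam\<in>{0<..} \<inter> \<rat>. f lam x) \<in> borel_measurable M"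
  proof (rule borel_measurable_cINF)
    show "countable ({0<..} \<inter> \<rat> :: real set)"
      by (rule countable_Int2) (rule countable_rat)
    show "f lam \<in> borel_measurable M" if "lam \<in> {0<..} \<inter> \<rat>" for lam
      using that meas by simp
    show "bdd_below ((\<lambda>lam. f lam x) ` ({0<..} \<inter> \<rat>))" for x
      by (rule bdd_below_mono[OF bdd]) auto
  qed
  ultimately show ?thesis
    by simp
qed

text \<open>
  The squared error of the diagonal Lasso, seen as a function of the regularisation alone:
  \<open>a\<close> are the curvatures, \<open>\<theta>\<close> the true coefficients and \<open>b\<close> the observed correlations.
\<close>

definition threshold_loss ::
    "nat \<Rightarrow> (nat \<Rightarrow> real) \<Rightarrow> (nat \<Rightarrow> real) \<Rightarrow> (nat \<Rightarrow> real) \<Rightarrow> real \<Rightarrow> real" where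
  "threshold_loss d a \<theta> b lam = (\<Sum>i<d. (soft_threshold (b i) lam / a i - \<theta> i)\<^sup>2)"

lemma threshold_loss_nonneg: "0 \<le> threshold_loss d a \<theta> b lam"
  by (simp add: threshold_loss_def sum_nonneg)

lemma integrable_INF_threshold_loss:
  assumes "prob_space M" and [measurable]: "\<And>i. i < d \<Longrightarrow> b i \<in> borel_measurable M"
  shows "integrable M (\<lambda>x. INF lam\<in>{0<..}. threshold_loss d a \<theta> (\<lambda>i. b i x) lam)"
proof -
  interpret prob_space M by fact
  let ?f = "\<lambda>lam x. threshold_loss d a \<theta> (\<lambda>i. b i x) lam"
  have bdd: "bdd_below ((\<lambda>lam. ?f lam x) ` {0<..})" for x
    using threshold_loss_nonneg by (intro bdd_belowI[where m = 0]) auto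
  have "(INF lam\<in>{0<..}. ?f lam x) \<le> (\<Sum>i<d. (\<theta> i)\<^sup>2)" for x
  proof -
    \<comment> \<open>This \<open>lam\<close> exceeds every \<open>\<bar>b i x\<bar>\<close>, so that all coordinates are thresholded to zero.\<close>
    define lam where "lam = 1 + (\<Sum>i<d. \<bar>b i x\<bar>)"
    have "lam > 0"
      unfolding lam_def by (intro add_pos_nonneg sum_nonneg) auto
    moreover have "\<bar>b i x\<bar> \<le> lam" if "i < d" for i
      using member_le_sum[of i "{..<d}" "\<lambda>i. \<bar>b i x\<bar>"] that by (simp add: lam_def)
    then have "?f lam x = (\<Sum>i<d. (\<theta> i)\<^sup>2)"
      by (auto simp: threshold_loss_def soft_threshold_eq_0 intro!: sum.cong)
    ultimately show ?thesis
      using cINF_lower[OF bdd, of lam x] by simp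
  qed
  moreover have "0 \<le> (INF lam\<in>{0<..}. ?f lam x)" for x
    by (rule cINF_greatest) (auto simp: threshold_loss_nonneg)
  moreover have "(\<lambda>x. INF lam\<in>{0<..}. ?f lam x) \<in> borel_measurable M"
  proof (rule borel_measurable_INF_continuous)
    show "?f lam \<in> borel_measurable M" for lam
      unfolding threshold_loss_def by measurable
    show "continuous_on {0<..} (\<lambda>lam. ?f lam x)" for x
      unfolding threshold_loss_def divide_inverse
      by (intro continuous_intros continuous_on_soft_threshold)
  qed (rule threshold_loss_nonneg)
  ultimately show ?thesis
    by (intro integrable_const_bound[where B = "\<Sum>i<d. (\<theta> i)\<^sup>2"]) auto
qed

section \<open>The error for small and for large regularisation\<close>

text \<open>
  Too little regularisation: an observation of size \<open>2 * l\<close> keeps at least \<open>l\<close> after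
  thresholding, all of which is error when the true coefficient is zero.
\<close>

lemma soft_threshold_noise:
  assumes "a > 0" and "lam \<le> l" and "2 * l \<le> \<bar>b\<bar>" and "0 \<le> lam"
  shows "(l / a)\<^sup>2 \<le> (soft_threshold b lam / a)\<^sup>2"
proof -
  have "l \<le> \<bar>soft_threshold b lam\<bar>"
    using assms(2-4) by (auto simp: soft_threshold_def)
  then have "\<bar>l / a\<bar> \<le> \<bar>soft_threshold b lam / a\<bar>"
    using assms by (simp add: divide_right_mono)
  then show ?thesis
    by (simp only: abs_le_square_iff)
qed

text \<open>
  Too much regularisation: an observation that does not exceed its mean \<open>a * M\<close> is shrunk by at
  least \<open>l\<close>, or all the way to zero, where the error is \<open>M\<close>.
\<close>

lemma soft_threshold_bias:
  assumes "a > 0" and "0 \<le> l" and "l \<le> lam" and "b \<le> a * M" and "0 \<le> M"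
  shows "(min M (l / a))\<^sup>2 \<le> (soft_threshold b lam / a - M)\<^sup>2"
proof -
  have "soft_threshold b lam \<le> max (a * M - l) 0"
    using assms by (auto simp: soft_threshold_def)
  then have "soft_threshold b lam / a \<le> max (a * M - l) 0 / a"
    using assms(1) by (simp add: divide_right_mono)
  also have "\<dots> = max (M - l / a) 0"
    using assms(1) by (auto simp: max_def field_simps)
  finally have "min M (l / a) \<le> M - soft_threshold b lam / a"
    by (auto simp: min_def max_def split: if_splits)
  moreover have "0 \<le> min M (l / a)"
    using assms by simp
  ultimately have "(min M (l / a))\<^sup>2 \<le> (M - soft_threshold b lam / a)\<^sup>2"
    by (intro power_mono) auto
  then show ?thesis
    by (simp add: power2_commute)
qed

text \<open>
  Since \<open>E / k\<close> and \<open>F / m\<close> lie in the unit interval, their minimum dominates their product.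
  This trades the minimum of two random sums for a bilinear expression, whose expectation
  requires only the joint law of pairs of coordinates and no concentration of the sums.
\<close>

lemma min_ge_product_of_averages:
  fixes u v E F k m :: real
  assumes "0 \<le> u" "0 \<le> v" "0 \<le> E" "E \<le> k" "0 \<le> F" "F \<le> m" "0 < k" "0 < m"
  shows "min (k * u) (m * v) * (E * F / (k * m)) \<le> min (u * E) (v * F)"
proof (rule min.boundedI)
  have e: "0 \<le> E / k" "E / k \<le> 1" and f: "0 \<le> F / m" "F / m \<le> 1"
    using assms by auto
  have "min (k * u) (m * v) * (E * F / (k * m)) = min (k * u) (m * v) * (E / k) * (F / m)"
    by simp
  also have "\<dots> \<le> (k * u) * (E / k) * 1"
    using assms e f by (intro mult_mono) auto
  finally show "min (k * u) (m * v) * (E * F / (k * m)) \<le> u * E"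
    using assms by simp
  have "min (k * u) (m * v) * (E * F / (k * m)) = min (k * u) (m * v) * (F / m) * (E / k)"
    by (simp add: mult_ac)
  also have "\<dots> \<le> (m * v) * (F / m) * 1"
    using assms e f by (intro mult_mono) auto
  finally show "min (k * u) (m * v) * (E * F / (k * m)) \<le> v * F"
    using assms by simp
qed

section \<open>The risk of a block signal\<close>

lemma isotropic_gaussian_pair:
  assumes "\<sigma> > 0" and "i < dim_vec \<mu>" "j < dim_vec \<mu>" "i \<noteq> j"
    and A: "A \<in> sets borel" and B: "B \<in> sets borel"
  shows "has_bochner_integral (isotropic_gaussian \<mu> \<sigma>)
    (\<lambda>\<omega>. indicator A (\<omega> i) * indicator B (\<omega> j))
    (measure (density lborel (normal_density (\<mu> $ i) \<sigma>)) A *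
     measure (density lborel (normal_density (\<mu> $ j) \<sigma>)) B)"
proof -
  let ?M = "\<lambda>i. density lborel (normal_density (\<mu> $ i) \<sigma>)"
  let ?I = "{..<dim_vec \<mu>}"
  have prob: "prob_space (?M l)" for l
    using assms(1) by (rule prob_space_normal_density)
  interpret M: prob_space "?M l" for l
    by (rule prob)
  interpret product_prob_space ?M ?I
    by unfold_locales
  define S where "S = {\<omega> \<in> space (PiM ?I ?M). \<omega> i \<in> A \<and> \<omega> j \<in> B}"
  have [measurable]: "A \<in> sets borel" "B \<in> sets borel"
    by fact+
  have comp: "(\<lambda>\<omega>. \<omega> l) \<in> borel_measurable (PiM ?I ?M)" if "l \<in> ?I" for l
    using measurable_component_singleton[OF that, of ?M]
      measurable_cong_sets[OF refl, of "?M l" borel "PiM ?I ?M"] by simp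
  have [measurable]: "(\<lambda>\<omega>. \<omega> i) \<in> borel_measurable (PiM ?I ?M)"
    by (rule comp) (use assms(2) in simp)
  have [measurable]: "(\<lambda>\<omega>. \<omega> j) \<in> borel_measurable (PiM ?I ?M)"
    by (rule comp) (use assms(3) in simp)
  have S: "S \<in> sets (PiM ?I ?M)"
    unfolding S_def by measurable
  have "S = {\<omega> \<in> space (PiM ?I ?M). \<forall>l\<in>{i, j}. \<omega> l \<in> (if l = i then A else B)}"
    using assms(4) by (auto simp: S_def)
  also have "emeasure (PiM ?I ?M) \<dots> = (\<Prod>l\<in>{i, j}. emeasure (?M l) (if l = i then A else B))"
    using assms by (intro emeasure_PiM_Collect) auto
  finally have "emeasure (PiM ?I ?M) S = (\<Prod>l\<in>{i, j}. emeasure (?M l) (if l = i then A else B))"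
    .
  also have "\<dots> = ennreal (measure (?M i) A * measure (?M j) B)"
    using assms(4) by (simp add: M.emeasure_eq_measure ennreal_mult)
  finally have em: "emeasure (PiM ?I ?M) S = ennreal (measure (?M i) A * measure (?M j) B)" .
  have "has_bochner_integral (PiM ?I ?M) (indicator S) (measure (PiM ?I ?M) S)"
    using S em by (intro has_bochner_integral_real_indicator) auto
  moreover have "measure (PiM ?I ?M) S = measure (?M i) A * measure (?M j) B"
    using em by (intro measure_eq_emeasure_eq_ennreal) auto
  ultimately have "has_bochner_integral (PiM ?I ?M) (indicator S) (measure (?M i) A * measure (?M j) B)"
    by simp
  moreover have "has_bochner_integral (PiM ?I ?M) (indicator S) (measure (?M i) A * measure (?M j) B)
      \<longleftrightarrow> has_bochner_integral (PiM ?I ?M) (\<lambda>\<omega>. indicator A (\<omega> i) * indicator B (\<omega> j))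
        (measure (?M i) A * measure (?M j) B)"
    by (rule has_bochner_integral_cong) (auto simp: S_def indicator_def)
  ultimately show ?thesis
    unfolding isotropic_gaussian_def by blast
qed

text \<open>
  The two arguments of the minimum are the costs of undersmoothing the first half of the
  coordinates (\<open>lam \<le> l\<close>) and of oversmoothing the signal block (\<open>l \<le> lam\<close>); the factor
  \<open>3 / 10 = 3 / 5 * (1 / 2)\<close> bounds from below the probability that both coordinates of a given
  pair are bad.
\<close>

lemma oracle_lasso_risk_block_signal:
  fixes n d m :: nat and \<sigma> B \<alpha> M :: real and X :: "real mat"
  assumes d: "2 \<le> d" and dn: "d \<le> n" and \<sigma>: "\<sigma> > 0" and B: "B > 0" and \<alpha>: "\<alpha> \<ge> 1"
    and design: "diagonal_design n d B \<alpha> X"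
    and m: "1 \<le> m" "m \<le> d - d div 2" and M: "M > 0"
  defines "\<theta> \<equiv> vec d (\<lambda>i. if i \<in> {d div 2..<d div 2 + m} then M else 0)"
  shows "3 / 10 * min (real (d div 2) * (\<sigma>\<^sup>2 * B / (16 * real n * \<alpha>)))
      (real m * (min M (sqrt (\<sigma>\<^sup>2 * B * \<alpha> / real n) / 4))\<^sup>2)
    \<le> oracle_lasso_risk X \<sigma> \<theta>"
proof -
  define k where "k = d div 2"
  define a where "a i = (if i < k then \<alpha> / B else 1 / B)" for i
  define x where "x i = X $$ (i, i)" for i
  define \<mu> where "\<mu> = X *\<^sub>v \<theta>"
  define b where "b i \<omega> = x i * \<omega> i / real n" for i and \<omega> :: "nat \<Rightarrow> real"
  define l where "l = \<sigma> / 4 * sqrt (\<alpha> / (real n * B))"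
  define u where "u = (l / (\<alpha> / B))\<^sup>2"
  define v where "v = (min M (l / (1 / B)))\<^sup>2"
  let ?S = "{k..<k + m}"
  let ?G = "isotropic_gaussian \<mu> \<sigma>"
  let ?t = "\<lambda>i. if i \<in> ?S then M else 0"
  let ?N = "\<lambda>i. density lborel (normal_density (\<mu> $ i) \<sigma>)"
  have k: "k \<ge> 1" and n: "n > 0" and km: "k + m \<le> d"
    using d dn m by (auto simp: k_def)
  have X: "X \<in> carrier_mat n d" "diagonal_mat X"
    using design by (auto simp: diagonal_design_def)
  have \<theta>: "\<theta> \<in> carrier_vec d"
    by (simp add: \<theta>_def)
  have \<theta>_nth: "\<theta> $ i = ?t i" if "i < d" for i
    using that by (simp add: \<theta>_def k_def)
  have a_pos: "a i > 0" for i
    using \<alpha> B by (simp add: a_def)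
  have xa: "(x i)\<^sup>2 / real n = a i" if "i < d" for i
    using diagonal_design_entries[OF design dn that] by (simp add: x_def a_def k_def)
  have dim: "dim_vec \<mu> = n"
    using X by (simp add: \<mu>_def)
  have \<mu>_nth: "\<mu> $ i = x i * ?t i" if "i < d" for i
    using diagonal_mult_mat_vec[OF X \<theta>, of i] that dn \<theta>_nth[OF that] by (simp add: \<mu>_def x_def)
  have l: "l > 0"
    using \<sigma> B \<alpha> n by (simp add: l_def)
  have sqrt_a: "sqrt (\<alpha> / B) / sqrt (real n) = sqrt (\<alpha> / (real n * B))"
    by (simp add: real_sqrt_divide real_sqrt_mult)
  have prob: "prob_space ?G"
    unfolding isotropic_gaussian_def
    by (intro prob_space_PiM prob_space_normal_density \<sigma>)
  interpret prob_space ?G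
    by (rule prob)
  have comp: "(\<lambda>\<omega>. \<omega> i) \<in> borel_measurable ?G" if "i < n" for i
    using measurable_component_singleton[of i "{..<n}" ?N] that
      measurable_cong_sets[OF refl, of "?N i" borel "PiM {..<n} ?N"]
    by (simp add: isotropic_gaussian_def dim)
  have b_meas: "b i \<in> borel_measurable ?G" if "i < d" for i
    using comp[of i] that dn unfolding b_def[abs_def]
    by (intro borel_measurable_divide borel_measurable_times borel_measurable_const) auto

  have risk: "oracle_lasso_risk X \<sigma> \<theta> =
      (\<integral>\<omega>. (INF lam\<in>{0<..}. threshold_loss d a ?t (\<lambda>i. b i \<omega>) lam) \<partial>?G)"
  proof -
    have "(lp_norm 2 (lasso X (vec (dim_row X) \<omega>) lam - \<theta>))\<^sup>2 = threshold_loss d a ?t (\<lambda>i. b i \<omega>) lam"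
      if "lam \<in> {0<..}" for lam \<omega>
    proof -
      have "lasso X (vec n \<omega>) lam = vec d (\<lambda>i. soft_threshold (x i * vec n \<omega> $ i / real n) lam / a i)"
        using lasso_diagonal[OF X dn, of "vec n \<omega>" lam a] that xa a_pos by (simp add: x_def)
      then show ?thesis
        using X dn \<theta> \<theta>_nth
        by (auto simp: lp_norm_2_squared threshold_loss_def b_def intro!: sum.cong)
    qed
    then show ?thesis
      unfolding oracle_lasso_risk_def \<mu>_def by (simp cong: INF_cong_simp)
  qed

  \<comment> \<open>The bad events: large noise on a signal-free coordinate \<open>i\<close>, and noise on a signal
    coordinate \<open>j\<close> that does not increase \<open>b j\<close>. Neither involves \<open>lam\<close>.\<close>
  define E F :: "nat \<Rightarrow> real set"
    where "E i = {w. \<sigma> / 2 \<le> \<bar>w - \<mu> $ i\<bar>}" and "F j = {w. x j * (w - \<mu> $ j) \<le> 0}" for i j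
  have noise: "indicator (E i) (\<omega> i) * u \<le> (soft_threshold (b i \<omega>) lam / a i - ?t i)\<^sup>2"
    if "i < k" "0 < lam" "lam \<le> l" for i \<omega> lam
  proof (cases "\<omega> i \<in> E i")
    case True
    have i: "i < d" "i \<notin> ?S"
      using that km by auto
    have "\<bar>x i\<bar> = sqrt (a i) * sqrt (real n)"
      using xa[OF i(1)] n by (subst real_sqrt_mult[symmetric], subst real_sqrt_abs[symmetric]) (simp add: field_simps)
    moreover have "a i = \<alpha> / B"
      using that(1) by (simp add: a_def)
    moreover have "sqrt (real n) / real n = 1 / sqrt (real n)"
      by (simp add: sqrt_divide_self_eq inverse_eq_divide)
    ultimately have "\<bar>x i\<bar> / real n = sqrt (\<alpha> / (real n * B))"
      by (simp only: sqrt_a[symmetric] times_divide_eq_right[symmetric]) simp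
    then have "\<bar>b i \<omega>\<bar> = sqrt (\<alpha> / (real n * B)) * \<bar>\<omega> i\<bar>"
      using n by (simp add: b_def abs_mult field_simps)
    moreover have "\<sigma> / 2 \<le> \<bar>\<omega> i\<bar>"
    proof -
      have "\<mu> $ i = 0"
        using \<mu>_nth[OF i(1)] i(2) by auto
      then show ?thesis
        using True by (simp add: E_def)
    qed
    then have "sqrt (\<alpha> / (real n * B)) * (\<sigma> / 2) \<le> sqrt (\<alpha> / (real n * B)) * \<bar>\<omega> i\<bar>"
      using \<alpha> B by (intro mult_left_mono) auto
    ultimately have "2 * l \<le> \<bar>b i \<omega>\<bar>"
      by (simp add: l_def mult_ac)
    then have "(l / a i)\<^sup>2 \<le> (soft_threshold (b i \<omega>) lam / a i)\<^sup>2"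
      using that a_pos by (intro soft_threshold_noise) auto
    then show ?thesis
      using True i \<open>a i = \<alpha> / B\<close> by (auto simp: u_def)
  qed simp
  have bias: "indicator (F j) (\<omega> j) * v \<le> (soft_threshold (b j \<omega>) lam / a j - ?t j)\<^sup>2"
    if "j \<in> ?S" "l \<le> lam" for j \<omega> lam
  proof (cases "\<omega> j \<in> F j")
    case True
    have j: "j < d" and aj: "a j = 1 / B"
      using that km by (auto simp: a_def)
    have "x j * \<omega> j \<le> (x j)\<^sup>2 * M"
      using True \<mu>_nth[OF j] that(1) by (simp add: F_def power2_eq_square algebra_simps)
    then have "b j \<omega> \<le> (x j)\<^sup>2 * M / real n"
      unfolding b_def by (rule divide_right_mono) simp
    also have "\<dots> = a j * M"
      by (simp add: xa[OF j, symmetric])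
    finally have "(min M (l / a j))\<^sup>2 \<le> (soft_threshold (b j \<omega>) lam / a j - M)\<^sup>2"
      using that a_pos l M by (intro soft_threshold_bias) auto
    then show ?thesis
      using True that(1) aj by (simp add: v_def)
  qed simp

  define e f :: "(nat \<Rightarrow> real) \<Rightarrow> real"
    where "e \<omega> = (\<Sum>i<k. indicator (E i) (\<omega> i))" and "f \<omega> = (\<Sum>j\<in>?S. indicator (F j) (\<omega> j))" for \<omega>
  have e: "0 \<le> e \<omega>" "e \<omega> \<le> real k" and f: "0 \<le> f \<omega>" "f \<omega> \<le> real m" for \<omega>
  proof -
    show "0 \<le> e \<omega>" "0 \<le> f \<omega>"
      by (simp_all add: e_def f_def sum_nonneg)
    have "e \<omega> \<le> (\<Sum>i<k. 1)" "f \<omega> \<le> (\<Sum>j\<in>?S. 1)"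
      unfolding e_def f_def by (intro sum_mono; simp add: indicator_def)+
    then show "e \<omega> \<le> real k" "f \<omega> \<le> real m"
      by simp_all
  qed
  define c where "c = min (real k * u) (real m * v)"
  have pathwise: "c * (e \<omega> * f \<omega> / (real k * real m))
      \<le> (INF lam\<in>{0<..}. threshold_loss d a ?t (\<lambda>i. b i \<omega>) lam)" for \<omega>
  proof (rule cINF_greatest)
    fix lam :: real assume "lam \<in> {0<..}"
    then have lam: "lam > 0" by simp
    let ?s = "\<lambda>i. (soft_threshold (b i \<omega>) lam / a i - ?t i)\<^sup>2"
    have "c * (e \<omega> * f \<omega> / (real k * real m)) \<le> min (u * e \<omega>) (v * f \<omega>)"
      unfolding c_def using e f k m by (intro min_ge_product_of_averages) (auto simp: u_def v_def)
    also have "\<dots> \<le> threshold_loss d a ?t (\<lambda>i. b i \<omega>) lam"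
    proof (cases "lam \<le> l")
      case True
      have "u * e \<omega> = (\<Sum>i<k. indicator (E i) (\<omega> i) * u)"
        by (simp add: e_def sum_distrib_left mult.commute)
      also have "\<dots> \<le> (\<Sum>i<k. ?s i)"
        using noise lam True by (intro sum_mono) auto
      also have "\<dots> \<le> (\<Sum>i<d. ?s i)"
        using km by (intro sum_mono2) auto
      finally show ?thesis
        by (simp add: threshold_loss_def min.coboundedI1)
    next
      case False
      have "v * f \<omega> = (\<Sum>j\<in>?S. indicator (F j) (\<omega> j) * v)"
        by (simp add: f_def sum_distrib_left mult.commute)
      also have "\<dots> \<le> (\<Sum>j\<in>?S. ?s j)"
        using bias False by (intro sum_mono) auto
      also have "\<dots> \<le> (\<Sum>i<d. ?s i)"
        using km by (intro sum_mono2) auto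
      finally show ?thesis
        by (simp add: threshold_loss_def min.coboundedI2)
    qed
    finally show "c * (e \<omega> * f \<omega> / (real k * real m)) \<le> threshold_loss d a ?t (\<lambda>i. b i \<omega>) lam" .
  qed simp

  have [measurable]: "E i \<in> sets borel" "F i \<in> sets borel" for i
    unfolding E_def F_def by measurable
  have pair: "has_bochner_integral ?G (\<lambda>\<omega>. indicator (E i) (\<omega> i) * indicator (F j) (\<omega> j))
      (measure (?N i) (E i) * measure (?N j) (F j))" if "i < k" "j \<in> ?S" for i j
    using that km dn \<sigma> by (intro isotropic_gaussian_pair) (auto simp: dim)
  have ef: "has_bochner_integral ?G (\<lambda>\<omega>. e \<omega> * f \<omega>)
      (\<Sum>i<k. \<Sum>j\<in>?S. measure (?N i) (E i) * measure (?N j) (F j))"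
    unfolding e_def f_def sum_product
    by (intro has_bochner_integral_sum pair) auto
  have "(\<Sum>i<k. \<Sum>j\<in>?S. 3 / 5 * (1 / 2))
      \<le> (\<Sum>i<k. \<Sum>j\<in>?S. measure (?N i) (E i) * measure (?N j) (F j))"
    unfolding E_def F_def using \<sigma>
    by (intro sum_mono mult_mono normal_anticoncentration normal_half_line) auto
  then have "3 / 10 * (real k * real m) \<le> (\<integral>\<omega>. e \<omega> * f \<omega> \<partial>?G)"
    using ef by (simp add: has_bochner_integral_integral_eq)
  moreover have "real k * real m > 0"
    using k m by simp
  ultimately have "3 / 10 \<le> (\<integral>\<omega>. e \<omega> * f \<omega> \<partial>?G) / (real k * real m)"
    by (simp add: pos_le_divide_eq)
  moreover have "c \<ge> 0"
    by (simp add: c_def u_def v_def)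
  ultimately have "3 / 10 * c \<le> (\<integral>\<omega>. e \<omega> * f \<omega> \<partial>?G) / (real k * real m) * c"
    by (rule mult_right_mono)
  also have "\<dots> = (\<integral>\<omega>. c * (e \<omega> * f \<omega> / (real k * real m)) \<partial>?G)"
    by (simp add: mult.commute)
  also have "\<dots> \<le> oracle_lasso_risk X \<sigma> \<theta>"
    unfolding risk
  proof (rule integral_mono)
    show "integrable ?G (\<lambda>\<omega>. c * (e \<omega> * f \<omega> / (real k * real m)))"
      using ef by (intro integrable_mult_right integrable_divide) (auto simp: has_bochner_integral_iff)
    show "integrable ?G (\<lambda>\<omega>. INF lam\<in>{0<..}. threshold_loss d a ?t (\<lambda>i. b i \<omega>) lam)"
      using prob b_meas by (rule integrable_INF_threshold_loss)
  qed (rule pathwise)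
  finally have "3 / 10 * c \<le> oracle_lasso_risk X \<sigma> \<theta>" .
  moreover have "u = \<sigma>\<^sup>2 * B / (16 * real n * \<alpha>)"
  proof -
    have "l\<^sup>2 = \<sigma>\<^sup>2 / 16 * (\<alpha> / (real n * B))"
      using \<alpha> B by (simp add: l_def power_mult_distrib power_divide)
    then show ?thesis
      using \<alpha> B n by (simp add: u_def power_divide power2_eq_square field_simps)
  qed
  moreover have "l / (1 / B) = sqrt (\<sigma>\<^sup>2 * B * \<alpha> / real n) / 4"
  proof -
    have "sqrt (\<sigma>\<^sup>2 * B * \<alpha> / real n) = sqrt ((\<sigma> * B)\<^sup>2 * (\<alpha> / (real n * B)))"
      using B n by (intro arg_cong[of _ _ sqrt]) (simp add: power2_eq_square field_simps)
    also have "\<dots> = \<sigma> * B * sqrt (\<alpha> / (real n * B))"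
      using \<sigma> B by (subst real_sqrt_mult) simp
    finally show ?thesis
      by (simp add: l_def)
  qed
  ultimately show ?thesis
    by (simp only: c_def v_def k_def)
qed

section \<open>Choosing the signal\<close>

text \<open>
  The common numerical part of both choices. With \<open>d div 2 \<ge> d / 3\<close>, the noise cost is at
  least \<open>1 / 48\<close> of the first term of the minimum, and the signal cost is at least
  \<open>m * (M / 4)\<^sup>2\<close>. The factor 2 in the last assumption leaves room for rounding \<open>m\<close> and for the
  block having only half of the coordinates at its disposal.
\<close>

lemma block_signal_bound:
  fixes n d m :: nat and \<sigma> B \<alpha> M r :: real and X :: "real mat"
  assumes d: "2 \<le> d" and dn: "d \<le> n" and \<sigma>: "\<sigma> > 0" and B: "B > 0" and \<alpha>: "\<alpha> \<ge> 1"
    and design: "diagonal_design n d B \<alpha> X"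
    and m: "1 \<le> m" "m \<le> d - d div 2"
    and M: "0 < M" "M \<le> sqrt (\<sigma>\<^sup>2 * B * \<alpha> / real n)"
    and r: "min (\<sigma>\<^sup>2 * B * real d / (real n * \<alpha>)) r \<le> 2 * (real m * M\<^sup>2)"
  shows "9 / 20000 * min (\<sigma>\<^sup>2 * B * real d / (real n * \<alpha>)) r
    \<le> oracle_lasso_risk X \<sigma> (vec d (\<lambda>i. if i \<in> {d div 2..<d div 2 + m} then M else 0))"
proof -
  define V where "V = \<sigma>\<^sup>2 * B * real d / (real n * \<alpha>)"
  have V: "V \<ge> 0"
    using B \<alpha> by (simp add: V_def)
  have "d \<le> 3 * (d div 2)"
    using d by linarith
  then have "real d / 3 \<le> real (d div 2)"
    by simp
  then have "real (d div 2) * (\<sigma>\<^sup>2 * B / (16 * real n * \<alpha>)) \<ge> real d / 3 * (\<sigma>\<^sup>2 * B / (16 * real n * \<alpha>))"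
    using B \<alpha> by (intro mult_right_mono) auto
  then have noise: "V / 48 \<le> real (d div 2) * (\<sigma>\<^sup>2 * B / (16 * real n * \<alpha>))"
    by (simp add: V_def field_simps)
  have "M / 4 \<le> min M (sqrt (\<sigma>\<^sup>2 * B * \<alpha> / real n) / 4)"
    using M by simp
  then have "(M / 4)\<^sup>2 \<le> (min M (sqrt (\<sigma>\<^sup>2 * B * \<alpha> / real n) / 4))\<^sup>2"
    using M by (intro power_mono) auto
  then have "real m * (M / 4)\<^sup>2 \<le> real m * (min M (sqrt (\<sigma>\<^sup>2 * B * \<alpha> / real n) / 4))\<^sup>2"
    by (intro mult_left_mono) auto
  moreover have "min V r / 32 \<le> real m * (M / 4)\<^sup>2"
    using r by (simp add: V_def power_divide)
  ultimately have bias: "min V r / 32 \<le> real m * (min M (sqrt (\<sigma>\<^sup>2 * B * \<alpha> / real n) / 4))\<^sup>2"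
    by linarith
  let ?b = "min (real (d div 2) * (\<sigma>\<^sup>2 * B / (16 * real n * \<alpha>)))
      (real m * (min M (sqrt (\<sigma>\<^sup>2 * B * \<alpha> / real n) / 4))\<^sup>2)"
  have "0 \<le> ?b"
    using B \<alpha> by simp
  moreover have "min V r / 48 \<le> ?b \<or> min V r < 0"
    using noise bias V by (auto simp: min_def)
  ultimately have "9 / 20000 * min V r \<le> 3 / 10 * ?b"
    by linarith
  also have "\<dots> \<le> oracle_lasso_risk X \<sigma> (vec d (\<lambda>i. if i \<in> {d div 2..<d div 2 + m} then M else 0))"
    using assms by (intro oracle_lasso_risk_block_signal)
  finally show ?thesis
    unfolding V_def .
qed

lemma sparse_vec_block:
  assumes "m \<le> s"
  shows "sparse_vec s (vec d (\<lambda>i. if i \<in> {k..<k + m} then M else 0))"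
proof -
  have "card {i. i < d \<and> vec d (\<lambda>i. if i \<in> {k..<k + m} then M else 0) $ i \<noteq> 0} \<le> card {k..<k + m}"
    by (intro card_mono) (auto split: if_splits)
  then show ?thesis
    using assms by (simp add: sparse_vec_def)
qed

lemma lp_norm_block:
  assumes "0 < p" "0 < M" "k + m \<le> d"
  shows "lp_norm p (vec d (\<lambda>i. if i \<in> {k..<k + m} then M else 0)) = (real m * M powr p) powr (1 / p)"
proof -
  have "(\<Sum>i<d. \<bar>if i \<in> {k..<k + m} then M else 0\<bar> powr p) = (\<Sum>i<d. if i \<in> {k..<k + m} then M powr p else 0)"
    using assms by (intro sum.cong) auto
  also have "\<dots> = (\<Sum>i\<in>{..<d} \<inter> {k..<k + m}. M powr p)"
    by (subst sum.inter_restrict) auto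
  also have "{..<d} \<inter> {k..<k + m} = {k..<k + m}"
    using assms by auto
  finally show ?thesis
    by (simp add: lp_norm_def)
qed

theorem theorem3:
  fixes n d :: nat and \<sigma> B \<alpha> :: real and X :: "real mat"
  assumes "2 \<le> d" and "d \<le> n"
    and "\<sigma> > 0" and "B > 0" and "\<alpha> \<ge> 1"
    and "diagonal_design n d B \<alpha> X"
  shows "(\<forall>p R. 0 < p \<and> p \<le> 1 \<and> 0 < R \<longrightarrow>
            (\<exists>\<theta>\<in>carrier_vec d. lp_norm p \<theta> \<le> R \<and>
               oracle_lasso_risk X \<sigma> \<theta> \<ge>
                 9 / 20000 *
                 Min {\<sigma>\<^sup>2 * B * real d / (real n * \<alpha>),
                      R\<^sup>2 * (\<sigma>\<^sup>2 * B / (R\<^sup>2 * real n) * \<alpha>) powr (1 - p / 2),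
                      R\<^sup>2}))
       \<and> (\<forall>s\<in>{1..d}.
            (\<exists>\<theta>\<in>carrier_vec d. sparse_vec s \<theta> \<and>
               oracle_lasso_risk X \<sigma> \<theta> \<ge>
                 9 / 20000 *
                 Min {\<sigma>\<^sup>2 * B * real d / (real n * \<alpha>),
                      \<sigma>\<^sup>2 * B * real s / real n * \<alpha>}))"
proof (intro conjI allI impI ballI)
  define V where "V = \<sigma>\<^sup>2 * B * real d / (real n * \<alpha>)"
  define Q where "Q = \<sigma>\<^sup>2 * B * \<alpha> / real n"
  define \<theta> where "\<theta> m M = vec d (\<lambda>i. if i \<in> {d div 2..<d div 2 + m} then M else (0 :: real))" for m M
  have \<theta>: "\<theta> m M \<in> carrier_vec d" for m M
    by (simp add: \<theta>_def)
  have n: "n > 0"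
    using assms(1,2) by simp
  have Q: "Q > 0"
    using assms n by (simp add: Q_def)
  have bound: "9 / 20000 * min V r \<le> oracle_lasso_risk X \<sigma> (\<theta> m M)"
    if "1 \<le> m" "m \<le> d - d div 2" "0 < M" "M \<le> sqrt Q" "min V r \<le> 2 * (real m * M\<^sup>2)" for m M r
    using block_signal_bound[OF assms, of m M r] that by (simp add: V_def Q_def \<theta>_def)
  \<comment> \<open>A signal of size \<open>sqrt Q\<close> on every available coordinate costs at least half of the first
    term \<open>V\<close>; this covers budgets too large to be spent at amplitude \<open>sqrt Q\<close>.\<close>
  have "V \<le> real d * Q"
  proof -
    have "1 * 1 \<le> \<alpha> * \<alpha>"
      using assms(5) by (intro mult_mono) auto
    then have "\<sigma>\<^sup>2 * B * real d / real n * 1 \<le> \<sigma>\<^sup>2 * B * real d / real n * (\<alpha> * \<alpha>)"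
      using assms(4) by (intro mult_left_mono) auto
    then show ?thesis
      using assms(5) n by (simp add: V_def Q_def field_simps)
  qed
  moreover have "real d \<le> 2 * real (d - d div 2)"
    by linarith
  then have "real d * Q \<le> 2 * real (d - d div 2) * Q"
    using Q by (intro mult_right_mono) auto
  ultimately have V: "V \<le> 2 * (real (d - d div 2) * Q)"
    by (simp only: mult.assoc)

  {
    fix p R :: real
    assume "0 < p \<and> p \<le> 1 \<and> 0 < R"
    then have p: "0 < p" and R: "0 < R" by auto
    let ?r = "R\<^sup>2 * (\<sigma>\<^sup>2 * B / (R\<^sup>2 * real n) * \<alpha>) powr (1 - p / 2)"
    have Min: "Min {V, ?r, R\<^sup>2} = min V (min ?r (R\<^sup>2))"
      by simp
    have "\<exists>m M. lp_norm p (\<theta> m M) \<le> R \<and>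
      9 / 20000 * min V (min ?r (R\<^sup>2)) \<le> oracle_lasso_risk X \<sigma> (\<theta> m M)"
    proof (cases "R \<le> sqrt Q")
      case True
      have "lp_norm p (\<theta> 1 R) = R"
        unfolding \<theta>_def using assms(1) p R by (subst lp_norm_block) (auto simp: powr_powr)
      moreover have "9 / 20000 * min V (min ?r (R\<^sup>2)) \<le> oracle_lasso_risk X \<sigma> (\<theta> 1 R)"
        using assms(1) R True by (intro bound) (auto simp: min_le_iff_disj)
      ultimately show ?thesis
        by (intro exI[of _ 1] exI[of _ R]) simp
    next
      case False
      define M where "M = sqrt Q"
      have M: "0 < M" "M < R" "M\<^sup>2 = Q"
        using False Q by (auto simp: M_def)
      \<comment> \<open>At amplitude \<open>M\<close>, the budget \<open>R\<close> in the \<open>lp\<close> norm pays for \<open>w\<close> coordinates.\<close>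
      define w where "w = (R / M) powr p"
      have w: "w \<ge> 1"
        unfolding w_def using M p by (intro ge_one_powr_ge_zero) auto
      define m where "m = min (nat \<lfloor>w\<rfloor>) (d - d div 2)"
      have m: "1 \<le> m" "m \<le> d - d div 2" "real m \<le> w"
        using w assms(1) by (auto simp: m_def le_nat_floor of_nat_floor min_le_iff_disj)
           linarith+
      have "lp_norm p (\<theta> m M) = (real m * M powr p) powr (1 / p)"
        unfolding \<theta>_def using m p M by (intro lp_norm_block) auto
      also have "\<dots> \<le> (w * M powr p) powr (1 / p)"
        using m p by (intro powr_mono2 mult_right_mono) auto
      also have "w * M powr p = R powr p"
        using M R by (simp add: w_def powr_divide)
      finally have "lp_norm p (\<theta> m M) \<le> R"
        using p R by (simp add: powr_powr)
      moreover have "?r = w * Q"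
      proof -
        have "\<sigma>\<^sup>2 * B / (R\<^sup>2 * real n) * \<alpha> = (M / R)\<^sup>2"
          by (simp add: power_divide M(3) Q_def)
        also have "\<dots> = (M / R) powr 2"
          using M R by simp
        finally have "?r = R\<^sup>2 * (M / R) powr (2 - p)"
          by (simp add: powr_powr algebra_simps)
        also have "\<dots> = R\<^sup>2 * ((M / R)\<^sup>2 / (M / R) powr p)"
          using M R by (simp add: powr_diff)
        also have "\<dots> = w * Q"
          using M R by (simp add: w_def powr_divide power_divide)
        finally show ?thesis .
      qed
      then have "min V (min ?r (R\<^sup>2)) \<le> 2 * (real m * M\<^sup>2)"
      proof (cases "nat \<lfloor>w\<rfloor> \<le> d - d div 2")
        case True
        then have "w \<le> 2 * real m"
          using w unfolding m_def by linarith
        then have "w * Q \<le> 2 * real m * Q"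
          using Q by (intro mult_right_mono) auto
        then show ?thesis
          using \<open>?r = w * Q\<close> by (simp add: M(3) min_le_iff_disj)
      next
        case False
        then show ?thesis
          using V by (simp add: m_def M(3) min_le_iff_disj)
      qed
      then have "9 / 20000 * min V (min ?r (R\<^sup>2)) \<le> oracle_lasso_risk X \<sigma> (\<theta> m M)"
        using m M by (intro bound) (auto simp: M_def)
      ultimately show ?thesis
        by blast
    qed
    then show "\<exists>\<theta>\<in>carrier_vec d. lp_norm p \<theta> \<le> R \<and>
        oracle_lasso_risk X \<sigma> \<theta> \<ge> 9 / 20000 * Min {\<sigma>\<^sup>2 * B * real d / (real n * \<alpha>), ?r, R\<^sup>2}"
      unfolding V_def[symmetric] Min using \<theta> by blast
  next
    fix s assume s: "s \<in> {1..d}"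
    define m where "m = min s (d - d div 2)"
    have m: "1 \<le> m" "m \<le> d - d div 2" "m \<le> s"
      using s assms(1) by (auto simp: m_def)
    have "s \<le> 2 * m"
      using s unfolding m_def by auto
    then have "real s * Q \<le> 2 * real m * Q"
      using Q by (intro mult_right_mono) auto
    then have "9 / 20000 * min V (real s * Q) \<le> oracle_lasso_risk X \<sigma> (\<theta> m (sqrt Q))"
      using m Q by (intro bound) (auto simp: min_le_iff_disj)
    moreover have "real s * Q = \<sigma>\<^sup>2 * B * real s / real n * \<alpha>"
      by (simp add: Q_def)
    moreover have "sparse_vec s (\<theta> m (sqrt Q))"
      unfolding \<theta>_def using m(3) by (rule sparse_vec_block)
    ultimately show "\<exists>\<theta>\<in>carrier_vec d. sparse_vec s \<theta> \<and>
        oracle_lasso_risk X \<sigma> \<theta> \<ge> 9 / 20000 *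
          Min {\<sigma>\<^sup>2 * B * real d / (real n * \<alpha>), \<sigma>\<^sup>2 * B * real s / real n * \<alpha>}"
      unfolding V_def[symmetric] using \<theta> by auto
  }
qed

end
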